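(* Let $\mathcal{M}$ be a chromatic moment functional and let $f\in\mathbf{L}^2_{\mathcal{M}}$. Then for every $u\in\mathbb{R}$ and every finite $c$ with $0<c<\frac{1}{2\rho}$, the chromatic series $$\sum_{k=0}^{\infty}(-1)^k\mathcal{K}^k[f](u)\,\mathcal{K}^k[\mathbf{m}](z-u)$$ converges to $f(z)$ uniformly on the strip $S(c)$.
   Context: $\mathcal{M}$ is a linear functional on real polynomials in $\omega$ with moments $\mu_n=\mathcal{M}(\omega^n)$, assumed positive definite (all Hankel determinants $\det(\mu_{i+j})_{0\le i,j\le n}$ are positive), symmetric ($\mu_{2n+1}=0$ for all $n$) and normalized ($\mu_0=1$). $\mathcal{M}$ is called chromatic if moreover the sequence $\mu_n^{1/n}/n$ is bounded; then $\rho=\limsup_{n\to\infty}(\mu_n/n!)^{1/n}<\infty$, with the convention $1/\rho=\infty$ if $\rho=0$. $P_n^{\mathcal{M}}$ are the orthonormal polynomials with respect to $\mathcal{M}$ ($\mathcal{M}(P_n^{\mathcal M}P_m^{\mathcal M})=\delta(m-n)$, $\deg P_n^{\mathcal M}=n$, positive leading coefficients, $P_0^{\mathcal M}=1$), and $\mathcal{K}^n=i^{-n}P_n^{\mathcal{M}}(iD)$, $D$ being differentiation (each $\omega^k$ in $P_n^{\mathcal M}(\omega)$ is replaced by $i^kD^k$). $a(\omega)$ is the moment distribution function: a non-decreasing bounded function with $\int_{-\infty}^{\infty}\omega^n\,da(\omega)=\mu_n$ for all $n$. For $0<b\le\infty$, $S(b)=\{z\in\mathbb{C}:|\mathrm{Im}\,z|<b\}$.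 $\mathbf{m}(z)=\int_{-\infty}^{\infty}e^{i\omega z}\,da(\omega)$, which is analytic on $S(1/\rho)$. $\mathbf{L}^2_{\mathcal{M}}$ is the vector space of functions $f:S(\frac{1}{2\rho})\to\mathbb{C}$ which are analytic on $S(\frac{1}{2\rho})$ and satisfy $\sum_{n=0}^{\infty}|\mathcal{K}^n[f](0)|^2<\infty$. *)

theory Defs
  imports "HOL-Complex_Analysis.Complex_Analysis" "Jordan_Normal_Form.Determinant"
begin

definition moment :: "(real poly \<Rightarrow> real) \<Rightarrow> nat \<Rightarrow> real" where
  "moment \<M> n = \<M> (monom 1 n)"

definition hankel_det :: "(real poly \<Rightarrow> real) \<Rightarrow> nat \<Rightarrow> real" where
  "hankel_det \<M> n =
     Determinant.det (Matrix.mat (n + 1) (n + 1) (\<lambda>(i, j). moment \<M> (i + j)))"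

definition moment_functional :: "(real poly \<Rightarrow> real) \<Rightarrow> bool" where
  "moment_functional \<M> \<longleftrightarrow>
     Vector_Spaces.linear Polynomial.smult (*) \<M> \<and>
     (\<forall>n. hankel_det \<M> n > 0) \<and>
     (\<forall>n. moment \<M> (2 * n + 1) = 0) \<and>
     moment \<M> 0 = 1"

text \<open>All moments are nonnegative here, so \<^const>\<open>root\<close> is the usual nonnegative
  root; the term at \<open>n = 0\<close> is \<open>0\<close> by convention and affects neither the
  boundedness below nor the limit superior.\<close>

definition chromatic :: "(real poly \<Rightarrow> real) \<Rightarrow> bool" where
  "chromatic \<M> \<longleftrightarrow>
     moment_functional \<M> \<and> bounded (range (\<lambda>n. root n (moment \<M> n) / real n))"

text \<open>The value is an extended real so that \<open>1 / 0 = \<infinity>\<close>, which holds in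
  \<^typ>\<open>ereal\<close>, gives the convention \<open>1 / \<rho> = \<infinity>\<close> for \<open>\<rho> = 0\<close>.\<close>

definition rho :: "(real poly \<Rightarrow> real) \<Rightarrow> ereal" where
  "rho \<M> = limsup (\<lambda>n. ereal (root n (moment \<M> n / fact n)))"

definition strip :: "ereal \<Rightarrow> complex set" where
  "strip b = {z. ereal \<bar>Im z\<bar> < b}"

definition orthonormal_polys :: "(real poly \<Rightarrow> real) \<Rightarrow> (nat \<Rightarrow> real poly) \<Rightarrow> bool" where
  "orthonormal_polys \<M> P \<longleftrightarrow>
     (\<forall>n m. \<M> (P n * P m) = (if m = n then 1 else 0)) \<and>
     (\<forall>n. degree (P n) = n \<and> lead_coeff (P n) > 0) \<and>
     P 0 = 1"

text \<open>The operator \<open>i\<^sup>-\<^sup>n P\<^sub>n(iD)\<close>.\<close>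

definition chromatic_deriv ::
    "(nat \<Rightarrow> real poly) \<Rightarrow> nat \<Rightarrow> (complex \<Rightarrow> complex) \<Rightarrow> complex \<Rightarrow> complex" where
  "chromatic_deriv P n f z =
     \<i> powi (- int n) *
     (\<Sum>k\<le>degree (P n). of_real (coeff (P n) k) * \<i> ^ k * (deriv ^^ k) f z)"

text \<open>A non-decreasing function need not be right-continuous, whereas
  \<^const>\<open>interval_measure\<close> is the Stieltjes measure only of right-continuous ones;
  hence the passage to right-hand limits, which does not change \<open>da\<close>.\<close>

definition stieltjes_measure :: "(real \<Rightarrow> real) \<Rightarrow> real measure" where
  "stieltjes_measure a = interval_measure (\<lambda>x. Lim (at_right x) a)"

definition moment_distribution :: "(real poly \<Rightarrow> real) \<Rightarrow> (real \<Rightarrow> real) \<Rightarrow> bool" where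
  "moment_distribution \<M> a \<longleftrightarrow>
     mono a \<and> bounded (range a) \<and>
     (\<forall>n. has_bochner_integral (stieltjes_measure a) (\<lambda>\<omega>. \<omega> ^ n) (moment \<M> n))"

definition fourier_stieltjes :: "(real \<Rightarrow> real) \<Rightarrow> complex \<Rightarrow> complex" where
  "fourier_stieltjes a z = (LINT \<omega>|stieltjes_measure a. exp (\<i> * of_real \<omega> * z))"

text \<open>Functions are total here; the strip is open, so the values of \<open>f\<close> outside it
  influence none of the conditions.\<close>

definition L2_space ::
    "(real poly \<Rightarrow> real) \<Rightarrow> (nat \<Rightarrow> real poly) \<Rightarrow> (complex \<Rightarrow> complex) set" where
  "L2_space \<M> P =
     {f. f analytic_on strip (1 / (2 * rho \<M>)) \<and>
         summable (\<lambda>n. (cmod (chromatic_deriv P n f 0))\<^sup>2)}"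

end

theory Submission
  imports Defs
begin

text \<open>
  Let \<open>A\<close> be the measure of \<open>a\<close> and \<open>m\<close> its transform. Up to powers of \<open>\<i>\<close> that cancel in the
  chromatic series, \<open>K\<^sup>n\<close> applied to \<open>\<integral> q(t) e\<^bsup>itz\<^esup> dA\<close> inserts the factor \<open>P\<^sub>n(-t)\<close>, and the
  polynomials \<open>P\<^sub>n(-t)\<close> are again orthonormal because odd moments vanish. Hence everything is controlled
  by Bessel's inequality for finite sums; neither completeness of \<open>L\<^sup>2(A)\<close> nor density of the polynomials
  is needed.

  For \<open>u = 0\<close>, Bessel's inequality for \<open>e\<^bsup>itz\<^esup>\<close> (square integrable since \<open>2c < 1/\<rho>\<close>) and Cauchy--Schwarz
  make the series uniformly Cauchy on \<open>S(c)\<close>. Its limit is holomorphic and has the same chromatic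
  derivatives at \<open>0\<close> as \<open>f\<close>, hence the same Taylor coefficients there, so it is \<open>f\<close>. For general \<open>u\<close>,
  Bessel's inequality for \<open>q(t) e\<^bsup>itu\<^esup>\<close>, where \<open>q\<close> comes from a partial sum of the series at \<open>0\<close>,
  gives \<open>\<Sum>\<bar>K\<^sup>n[f](u)\<bar>\<^sup>2 \<le> \<Sum>\<bar>K\<^sup>n[f](0)\<bar>\<^sup>2\<close>, and the case \<open>u = 0\<close> applies to \<open>z \<mapsto> f(z + u)\<close>.
\<close>

section \<open>Exponential bounds for powers, polynomials and
  \<open>exp (\<i> * t * z)\<close>\<close>

lemma power_le_fact_exp:
  fixes x :: real
  assumes "0 \<le> x"
  shows "x ^ n \<le> fact n * exp x"
proof -
  have "(\<lambda>k. x ^ k /\<^sub>R fact k) sums exp x"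
    by (rule exp_converges)
  then have "sum (\<lambda>k. x ^ k /\<^sub>R fact k) {n} \<le> exp x"
    using assms sum_le_suminf[of "\<lambda>k. x ^ k /\<^sub>R fact k" "{n}"] by (simp add: sums_iff)
  then show ?thesis
    by (simp add: field_simps)
qed

text \<open>This lets one half of the weight \<open>exp (2 * c * \<bar>t\<bar>)\<close> absorb a
  polynomial, while the other half dominates the exponential kernel on the strip.\<close>

lemma poly_exp_bound:
  fixes q :: "complex poly"
  assumes "0 < c"
  obtains C where "\<And>t::real. norm (poly q (of_real t)) \<le> C * exp (c * \<bar>t\<bar>)"
proof
  fix t :: real
  have "\<bar>t\<bar> ^ k \<le> fact k / c ^ k * exp (c * \<bar>t\<bar>)" for k
    using power_le_fact_exp[of "c * \<bar>t\<bar>" k] assms by (simp add: field_simps)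
  then have le: "norm (coeff q k * of_real t ^ k)
      \<le> norm (coeff q k) * (fact k / c ^ k) * exp (c * \<bar>t\<bar>)" for k
    unfolding norm_mult norm_power norm_of_real mult.assoc by (intro mult_left_mono) auto
  have "norm (poly q (of_real t)) \<le> (\<Sum>k\<le>degree q. norm (coeff q k * of_real t ^ k))"
    unfolding poly_altdef by (rule norm_sum)
  also have "\<dots> \<le> (\<Sum>k\<le>degree q. norm (coeff q k) * (fact k / c ^ k) * exp (c * \<bar>t\<bar>))"
    by (rule sum_mono) (rule le)
  finally show "norm (poly q (of_real t))
      \<le> (\<Sum>k\<le>degree q. norm (coeff q k) * (fact k / c ^ k)) * exp (c * \<bar>t\<bar>)"
    unfolding sum_distrib_right .
qed

lemma borel_measurable_poly [measurable]:
  fixes q :: "'a::real_normed_field poly"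
  shows "poly q \<in> borel_measurable borel"
  by (intro borel_measurable_continuous_onI continuous_intros)

lemma norm_exp_imaginary_le:
  assumes "\<bar>Im z\<bar> \<le> c"
  shows "norm (exp (\<i> * of_real t * z)) \<le> exp (c * \<bar>t\<bar>)"
proof -
  have "- (t * Im z) \<le> \<bar>t\<bar> * \<bar>Im z\<bar>"
    by (metis abs_ge_minus_self abs_mult)
  also have "\<dots> \<le> \<bar>t\<bar> * c"
    using assms by (intro mult_left_mono) auto
  finally show ?thesis
    by (simp add: mult.commute)
qed

section \<open>Transforms of polynomial densities on a strip\<close>

text \<open>The rate is \<open>2 * c\<close> rather than \<open>c\<close> so that the kernel is
  square integrable for \<open>\<bar>Im z\<bar> \<le> c\<close>, as Bessel's inequality requires,
  and so that polynomial factors cost nothing.\<close>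

locale exp_integrable_measure =
  fixes A :: "real measure" and c :: real
  assumes sets_A [simp, measurable_cong]: "sets A = sets borel"
    and c_pos: "0 < c"
    and integrable_exp: "integrable A (\<lambda>t. exp (2 * c * \<bar>t\<bar>))"
begin

text \<open>Carrying the polynomial \<open>q\<close> makes the class closed under differentiation,
  which multiplies \<open>q\<close> by \<open>\<i> * t\<close>. The choice \<open>q = 1\<close>
  gives the transform of the measure itself.\<close>

definition fourier :: "complex poly \<Rightarrow> complex \<Rightarrow> complex" where
  "fourier q z = (LINT t|A. poly q (of_real t) * exp (\<i> * of_real t * z))"

lemma integrable_fourier_dominant:
  "integrable A (\<lambda>t. norm (poly q (complex_of_real t)) * exp (c * \<bar>t\<bar>))"
proof -
  obtain C where C: "\<And>t::real. norm (poly q (of_real t)) \<le> C * exp (c * \<bar>t\<bar>)"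
    using poly_exp_bound[OF c_pos] by metis
  show ?thesis
  proof (rule Bochner_Integration.integrable_bound)
    show "integrable A (\<lambda>t. C * exp (2 * c * \<bar>t\<bar>))"
      using integrable_exp by simp
    show "AE t in A. norm (norm (poly q (of_real t)) * exp (c * \<bar>t\<bar>)) \<le> norm (C * exp (2 * c * \<bar>t\<bar>))"
    proof (rule AE_I2)
      fix t :: real
      have "norm (poly q (of_real t)) * exp (c * \<bar>t\<bar>) \<le> C * exp (c * \<bar>t\<bar>) * exp (c * \<bar>t\<bar>)"
        using C by (intro mult_right_mono) auto
      also have "\<dots> = C * exp (2 * c * \<bar>t\<bar>)"
        by (simp add: mult.assoc flip: exp_add)
      finally show "norm (norm (poly q (of_real t)) * exp (c * \<bar>t\<bar>)) \<le> norm (C * exp (2 * c * \<bar>t\<bar>))"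
        by simp
    qed
  qed simp
qed

lemma integrable_fourier:
  assumes "\<bar>Im z\<bar> \<le> c"
  shows "integrable A (\<lambda>t. poly q (of_real t) * exp (\<i> * of_real t * z))"
proof (rule Bochner_Integration.integrable_bound[OF integrable_fourier_dominant])
  show "AE t in A. norm (poly q (of_real t) * exp (\<i> * of_real t * z))
      \<le> norm (norm (poly q (of_real t)) * exp (c * \<bar>t\<bar>))"
    using norm_exp_imaginary_le[OF assms]
    by (intro AE_I2) (simp add: norm_mult mult_left_mono del: norm_exp_eq_Re)
qed simp

lemma integrable_poly: "integrable A (\<lambda>t. poly q (complex_of_real t))"
  using integrable_fourier[of 0 q] c_pos by simp

lemma fourier_sum:
  assumes "\<bar>Im z\<bar> \<le> c"
  shows "fourier (\<Sum>k\<in>K. Polynomial.smult (d k) (q k)) z = (\<Sum>k\<in>K. d k * fourier (q k) z)"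
proof -
  have "poly (\<Sum>k\<in>K. Polynomial.smult (d k) (q k)) (of_real t) * exp (\<i> * of_real t * z)
      = (\<Sum>k\<in>K. d k * (poly (q k) (of_real t) * exp (\<i> * of_real t * z)))" for t
    by (simp only: poly_sum poly_smult sum_distrib_right mult.assoc)
  then have "fourier (\<Sum>k\<in>K. Polynomial.smult (d k) (q k)) z
      = (LINT t|A. (\<Sum>k\<in>K. d k * (poly (q k) (of_real t) * exp (\<i> * of_real t * z))))"
    by (simp only: fourier_def)
  also have "\<dots> = (\<Sum>k\<in>K. LINT t|A. d k * (poly (q k) (of_real t) * exp (\<i> * of_real t * z)))"
    by (intro Bochner_Integration.integral_sum Bochner_Integration.integrable_mult_right integrable_fourier assms)
  also have "\<dots> = (\<Sum>k\<in>K. d k * fourier (q k) z)"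
    by (simp only: fourier_def integral_mult_right_zero)
  finally show ?thesis .
qed

text \<open>Differentiation under the integral sign: the first-order Taylor remainder of the kernel
  is quadratic in \<open>h\<close>, with a dominating function that does not depend on
  \<open>h\<close>.\<close>

lemma has_field_derivative_fourier:
  assumes z: "\<bar>Im z\<bar> < c"
  shows "(fourier q has_field_derivative fourier (pCons 0 (Polynomial.smult \<i> q)) z) (at z)"
proof -
  \<comment> \<open>The remainder contributes \<open>norm w ^ 2\<close> with
    \<open>w = \<i> * t * h\<close>; its factor \<open>t ^ 2\<close> is moved into the
    polynomial.\<close>
  define q2 where "q2 = [:0, 0, 1:] * q"
  define K where "K = (LINT t|A. norm (poly q2 (of_real t)) * exp (c * \<bar>t\<bar>))"
  have K: "norm (fourier q (z + h) - fourier q z - h * fourier (pCons 0 (Polynomial.smult \<i> q)) z) \<le> K * norm h ^ 2"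
    if h: "norm h < c - \<bar>Im z\<bar>" for h
  proof -
    have zh: "\<bar>Im (z + h)\<bar> \<le> c"
      using h abs_Im_le_cmod[of h] by simp
    have bound: "norm (poly q (of_real t) * exp (\<i> * of_real t * (z + h))
          - poly q (of_real t) * exp (\<i> * of_real t * z)
          - h * (poly (pCons 0 (Polynomial.smult \<i> q)) (of_real t) * exp (\<i> * of_real t * z)))
        \<le> norm h ^ 2 * (norm (poly q2 (of_real t)) * exp (c * \<bar>t\<bar>))" for t
    proof -
      define w where "w = \<i> * of_real t * h"
      have "norm (exp w - 1 - w) \<le> exp \<bar>Re w\<bar> * norm w ^ 2"
        using Taylor_exp[of w 1] by (simp add: algebra_simps numeral_2_eq_2)
      \<comment> \<open>The Taylor bound costs the factor \<open>exp \<bar>Re w\<bar>\<close>, at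
        most \<open>exp (\<bar>t\<bar> * \<bar>Im h\<bar>)\<close>. It fits into the weight because
        \<open>norm h < c - \<bar>Im z\<bar>\<close>.\<close>
      moreover have "norm (exp (\<i> * of_real t * z)) * exp \<bar>Re w\<bar> \<le> exp (c * \<bar>t\<bar>)"
      proof -
        have "- (t * Im z) + \<bar>Re w\<bar> \<le> \<bar>t\<bar> * \<bar>Im z\<bar> + \<bar>t\<bar> * \<bar>Im h\<bar>"
          unfolding w_def by (simp add: abs_mult) (metis abs_ge_minus_self abs_mult)
        also have "\<dots> = \<bar>t\<bar> * (\<bar>Im z\<bar> + \<bar>Im h\<bar>)"
          by (simp add: algebra_simps)
        also have "\<dots> \<le> \<bar>t\<bar> * c"
          using h abs_Im_le_cmod[of h] by (intro mult_left_mono) auto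
        finally show ?thesis
          by (simp add: mult.commute flip: exp_add)
      qed
      ultimately have "norm (exp (\<i> * of_real t * z)) * norm (exp w - 1 - w) \<le> exp (c * \<bar>t\<bar>) * norm w ^ 2"
      proof -
        assume *: "norm (exp w - 1 - w) \<le> exp \<bar>Re w\<bar> * norm w ^ 2"
          and **: "norm (exp (\<i> * of_real t * z)) * exp \<bar>Re w\<bar> \<le> exp (c * \<bar>t\<bar>)"
        have "norm (exp (\<i> * of_real t * z)) * norm (exp w - 1 - w)
            \<le> norm (exp (\<i> * of_real t * z)) * (exp \<bar>Re w\<bar> * norm w ^ 2)"
          using * by (rule mult_left_mono) (rule norm_ge_zero)
        also have "\<dots> = (norm (exp (\<i> * of_real t * z)) * exp \<bar>Re w\<bar>) * norm w ^ 2"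
          by (rule mult.assoc[symmetric])
        also have "\<dots> \<le> exp (c * \<bar>t\<bar>) * norm w ^ 2"
          using ** by (rule mult_right_mono) (rule zero_le_power2)
        finally show ?thesis .
      qed
      then have "norm (poly q (of_real t)) * (norm (exp (\<i> * of_real t * z)) * norm (exp w - 1 - w))
          \<le> norm (poly q (of_real t)) * (exp (c * \<bar>t\<bar>) * norm w ^ 2)"
        by (intro mult_left_mono) auto
      moreover have "poly q (of_real t) * exp (\<i> * of_real t * (z + h))
          - poly q (of_real t) * exp (\<i> * of_real t * z)
          - h * (poly (pCons 0 (Polynomial.smult \<i> q)) (of_real t) * exp (\<i> * of_real t * z))
          = poly q (of_real t) * (exp (\<i> * of_real t * z) * (exp w - 1 - w))"
        by (simp add: w_def algebra_simps exp_add)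
      moreover have "norm (poly q (of_real t)) * (exp (c * \<bar>t\<bar>) * norm w ^ 2)
          = norm h ^ 2 * (norm (poly q2 (of_real t)) * exp (c * \<bar>t\<bar>))"
        by (simp add: w_def q2_def norm_mult power_mult_distrib power2_eq_square mult_ac)
      ultimately show ?thesis
        by (simp only: norm_mult)
    qed
    have eq: "fourier q (z + h) - fourier q z - h * fourier (pCons 0 (Polynomial.smult \<i> q)) z =
       (LINT t|A. poly q (of_real t) * exp (\<i> * of_real t * (z + h))
          - poly q (of_real t) * exp (\<i> * of_real t * z)
          - h * (poly (pCons 0 (Polynomial.smult \<i> q)) (of_real t) * exp (\<i> * of_real t * z)))"
      unfolding fourier_def using z zh integrable_fourier
      by (simp add: Bochner_Integration.integral_diff integrable_fourier del: poly_pCons poly_smult)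
    have "norm (fourier q (z + h) - fourier q z - h * fourier (pCons 0 (Polynomial.smult \<i> q)) z)
        \<le> (LINT t|A. norm h ^ 2 * (norm (poly q2 (of_real t)) * exp (c * \<bar>t\<bar>)))"
      unfolding eq
    proof (rule Bochner_Integration.integral_norm_bound_integral[OF _ _ bound])
      show "integrable A (\<lambda>t. poly q (of_real t) * exp (\<i> * of_real t * (z + h))
          - poly q (of_real t) * exp (\<i> * of_real t * z)
          - h * (poly (pCons 0 (Polynomial.smult \<i> q)) (of_real t) * exp (\<i> * of_real t * z)))"
        by (intro Bochner_Integration.integrable_diff Bochner_Integration.integrable_mult_right
            integrable_fourier zh less_imp_le[OF z])
      show "integrable A (\<lambda>t. norm h ^ 2 * (norm (poly q2 (of_real t)) * exp (c * \<bar>t\<bar>)))"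
        by (intro Bochner_Integration.integrable_mult_right integrable_fourier_dominant)
    qed
    then show ?thesis
      by (simp add: K_def mult.commute)
  qed
  have "((\<lambda>h. (fourier q (z + h) - fourier q z) / h - fourier (pCons 0 (Polynomial.smult \<i> q)) z) \<longlongrightarrow> 0) (at 0)"
  proof (rule Lim_null_comparison)
    have "\<forall>\<^sub>F h in at 0. norm h < c - \<bar>Im z\<bar> \<and> h \<noteq> 0"
      using z by (auto simp: eventually_at dist_norm intro!: exI[of _ "c - \<bar>Im z\<bar>"])
    then show "\<forall>\<^sub>F h in at 0. norm ((fourier q (z + h) - fourier q z) / h
        - fourier (pCons 0 (Polynomial.smult \<i> q)) z) \<le> K * norm h"
    proof eventually_elim
      case (elim h)
      then have "(fourier q (z + h) - fourier q z) / h - fourier (pCons 0 (Polynomial.smult \<i> q)) z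
          = (fourier q (z + h) - fourier q z - h * fourier (pCons 0 (Polynomial.smult \<i> q)) z) / h"
        by (simp add: field_simps)
      then show ?case
        using K[of h] elim by (simp add: norm_divide divide_le_eq power2_eq_square mult.assoc)
    qed
    show "((\<lambda>h. K * norm h) \<longlongrightarrow> 0) (at 0)"
      by (auto intro!: tendsto_eq_intros)
  qed
  then show ?thesis
    unfolding DERIV_def using LIM_zero_iff by blast
qed

lemma open_strip_c: "open {z. \<bar>Im z\<bar> < c}"
  by (intro open_Collect_less continuous_intros)

lemma higher_deriv_fourier:
  assumes "\<bar>Im z\<bar> < c"
  shows "(deriv ^^ n) (fourier q) z = fourier ([:0, \<i>:] ^ n * q) z"
  using assms
proof (induction n arbitrary: z)
  case (Suc n)
  \<comment> \<open>Differentiating once more requires the induction hypothesis in a neighbourhood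
    of \<open>z\<close>, which the open strip provides.\<close>
  have "\<forall>\<^sub>F w in nhds z. w \<in> {z. \<bar>Im z\<bar> < c}"
    using Suc.prems open_strip_c by (intro eventually_nhds_in_open) auto
  then have "\<forall>\<^sub>F w in nhds z. (deriv ^^ n) (fourier q) w = fourier ([:0, \<i>:] ^ n * q) w"
    by eventually_elim (use Suc.IH in auto)
  then have "deriv ((deriv ^^ n) (fourier q)) z = deriv (fourier ([:0, \<i>:] ^ n * q)) z"
    by (intro deriv_cong_ev) auto
  also have "\<dots> = fourier (pCons 0 (Polynomial.smult \<i> ([:0, \<i>:] ^ n * q))) z"
    by (intro DERIV_imp_deriv has_field_derivative_fourier Suc.prems)
  finally show ?case
    by (simp add: mult.assoc)
qed simp

lemma holomorphic_fourier: "fourier q holomorphic_on {z. \<bar>Im z\<bar> < c}"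
  using has_field_derivative_fourier open_strip_c by (subst holomorphic_on_open) auto

end

section \<open>The operators \<open>p(iD)\<close> and their action on transforms\<close>

text \<open>The operator \<open>p(iD)\<close>, i.e. the chromatic derivative without its unimodular factor.\<close>

definition diff_op :: "real poly \<Rightarrow> (complex \<Rightarrow> complex) \<Rightarrow> complex \<Rightarrow> complex" where
  "diff_op p h z = (\<Sum>k\<le>degree p. of_real (coeff p k) * \<i> ^ k * (deriv ^^ k) h z)"

lemma diff_op_shift: "diff_op p (\<lambda>z. h (z + u)) 0 = diff_op p h u"
  unfolding diff_op_def
  by (subst (2) higher_deriv_shift_0) (simp add: o_def add.commute)

text \<open>By Weierstrass' theorem each derivative passes to the limit, and only finitely many
  derivatives occur.\<close>

lemma tendsto_diff_op:
  assumes "uniform_limit S s g sequentially" "\<And>N. s N holomorphic_on S" "open S" "z \<in> S"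
  shows "(\<lambda>N. diff_op p (s N) z) \<longlonglongrightarrow> diff_op p g z"
  unfolding diff_op_def using assms
  by (intro tendsto_sum tendsto_mult tendsto_const higher_deriv_complex_uniform_limit) auto

text \<open>Since \<open>P n\<close> has degree exactly \<open>n\<close>, the operators form a
  triangular system in the derivatives with nonzero diagonal, solved by strong induction.\<close>

lemma higher_derivs_eq_if_diff_ops_eq:
  assumes "\<And>n. degree (P n) = n" "\<And>n. P n \<noteq> 0"
    and "\<And>n. diff_op (P n) f z = diff_op (P n) g z"
  shows "(deriv ^^ n) f z = (deriv ^^ n) g z"
proof (induction n rule: less_induct)
  case (less n)
  have split: "diff_op (P n) h z = (\<Sum>k<n. of_real (coeff (P n) k) * \<i> ^ k * (deriv ^^ k) h z)
      + of_real (coeff (P n) n) * \<i> ^ n * (deriv ^^ n) h z" for h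
    unfolding diff_op_def assms(1) lessThan_Suc_atMost[symmetric] by (rule sum.lessThan_Suc)
  have "coeff (P n) n \<noteq> 0"
    using assms(1,2)[of n] leading_coeff_0_iff[of "P n"] by simp
  moreover have "(\<Sum>k<n. of_real (coeff (P n) k) * \<i> ^ k * (deriv ^^ k) f z)
      = (\<Sum>k<n. of_real (coeff (P n) k) * \<i> ^ k * (deriv ^^ k) g z)"
    using less.IH by (intro sum.cong) auto
  ultimately show ?case
    using assms(3)[of n] unfolding split by simp
qed

text \<open>The polynomial \<open>p(-t)\<close>, written as \<open>p(\<i> \<cdot> \<i>t)\<close> so that its terms match those of \<open>diff_op p\<close>
  applied to \<open>e\<^bsup>itz\<^esup>\<close>.\<close>

definition mirror :: "real poly \<Rightarrow> complex poly" where
  "mirror p = (\<Sum>k\<le>degree p. Polynomial.smult (of_real (coeff p k) * \<i> ^ k) ([:0, \<i>:] ^ k))"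

lemma poly_mirror: "poly (mirror p) (of_real t) = of_real (poly p (- t))"
proof -
  have "\<i> ^ k * (of_real t * \<i>) ^ k = of_real ((- t) ^ k)" for k
    by (simp add: mult.left_commute[of "\<i>"] flip: power_mult_distrib)
  then have "of_real (coeff p k) * \<i> ^ k * (of_real t * \<i>) ^ k = of_real (coeff p k * (- t) ^ k)" for k
    by (simp only: mult.assoc of_real_mult)
  then show ?thesis
    by (simp add: mirror_def poly_sum poly_altdef[of p] del: of_real_mult of_real_power)
qed

context exp_integrable_measure
begin

text \<open>The operator \<open>iD\<close> multiplies \<open>exp (\<i> * t * z)\<close> by
  \<open>\<i> * (\<i> * t) = - t\<close>, so \<open>p(iD)\<close> inserts the factor
  \<open>p(-t)\<close>.\<close>

lemma diff_op_fourier: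
  assumes "\<bar>Im z\<bar> < c"
  shows "diff_op p (fourier q) z = fourier (mirror p * q) z"
proof -
  have "diff_op p (fourier q) z
      = fourier (\<Sum>k\<le>degree p. Polynomial.smult (of_real (coeff p k) * \<i> ^ k) ([:0, \<i>:] ^ k * q)) z"
    using assms unfolding diff_op_def by (subst fourier_sum) (simp_all add: higher_deriv_fourier)
  also have "(\<Sum>k\<le>degree p. Polynomial.smult (of_real (coeff p k) * \<i> ^ k) ([:0, \<i>:] ^ k * q))
      = mirror p * q"
    unfolding mirror_def sum_distrib_right by simp
  finally show ?thesis .
qed

end

section \<open>Orthonormal polynomials and Bessel's inequality\<close>

text \<open>Orthonormality is asked of the reflected polynomials, the factors that the operators
  insert; the symmetry of the functional enters when the locale is interpreted.\<close>

locale orthonormal_exp_measure = exp_integrable_measure +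
  fixes P :: "nat \<Rightarrow> real poly"
  assumes degree_P: "degree (P n) = n"
    and orthonormal: "(LINT t|A. poly (P m) (- t) * poly (P n) (- t)) = (if m = n then 1 else 0)"
begin

lemma P_nonzero: "P n \<noteq> 0"
  using orthonormal[of n n] by auto

lemma integrable_poly_mult: "integrable A (\<lambda>t. poly (P m) (- t) * poly (P n) (- t))"
  using integrable_poly[of "mirror (P m) * mirror (P n)"]
  by (simp add: poly_mirror complex_of_real_integrable_eq flip: of_real_mult)

text \<open>Pythagoras for finite sums: the square expands into a double sum, of which
  orthonormality leaves only the diagonal.\<close>

lemma
  fixes d :: "nat \<Rightarrow> complex"
  shows integrable_norm_square_sum: "integrable A (\<lambda>t. (norm (\<Sum>k<N. d k * poly (P k) (- t)))\<^sup>2)"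
    and integral_norm_square_sum:
      "(LINT t|A. (norm (\<Sum>k<N. d k * poly (P k) (- t)))\<^sup>2) = (\<Sum>k<N. (norm (d k))\<^sup>2)"
proof -
  have eq: "(norm (\<Sum>k<N. d k * poly (P k) (- t)))\<^sup>2
      = (\<Sum>j<N. \<Sum>k<N. Re (d j * cnj (d k)) * (poly (P j) (- t) * poly (P k) (- t)))" for t
  proof -
    have "(norm (\<Sum>k<N. d k * poly (P k) (- t)))\<^sup>2
        = Re ((\<Sum>k<N. d k * poly (P k) (- t)) * cnj (\<Sum>k<N. d k * poly (P k) (- t)))"
      by (simp only: complex_norm_square[symmetric] Re_complex_of_real)
    also have "\<dots> = (\<Sum>j<N. \<Sum>k<N. Re ((d j * poly (P j) (- t)) * cnj (d k * poly (P k) (- t))))"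
      unfolding cnj_sum sum_product Re_sum ..
    also have "\<dots> = (\<Sum>j<N. \<Sum>k<N. Re (d j * cnj (d k)) * (poly (P j) (- t) * poly (P k) (- t)))"
      by (intro sum.cong refl) (simp add: algebra_simps)
    finally show ?thesis .
  qed
  show "integrable A (\<lambda>t. (norm (\<Sum>k<N. d k * poly (P k) (- t)))\<^sup>2)"
    unfolding eq
    by (intro Bochner_Integration.integrable_sum Bochner_Integration.integrable_mult_right integrable_poly_mult)
  have "(LINT t|A. (norm (\<Sum>k<N. d k * poly (P k) (- t)))\<^sup>2)
      = (\<Sum>j<N. \<Sum>k<N. Re (d j * cnj (d k)) * (if j = k then 1 else 0))"
    unfolding eq by (simp only: Bochner_Integration.integral_sum Bochner_Integration.integrable_sum
        Bochner_Integration.integrable_mult_right integrable_poly_mult integral_mult_right_zero orthonormal)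
  also have "\<dots> = (\<Sum>j<N. Re (d j * cnj (d j)))"
    by (simp add: if_distrib sum.delta' cong: if_cong)
  also have "\<dots> = (\<Sum>j<N. (norm (d j))\<^sup>2)"
    by (simp only: complex_norm_square[symmetric] Re_complex_of_real)
  finally show "(LINT t|A. (norm (\<Sum>k<N. d k * poly (P k) (- t)))\<^sup>2) = (\<Sum>k<N. (norm (d k))\<^sup>2)" .
qed

text \<open>With \<open>S\<close> the combination of the polynomials whose coefficients are those of
  \<open>g\<close>, expanding \<open>0 \<le> \<integral> (norm (g - S))\<^sup>2\<close> leaves the
  right-hand side minus the left-hand side.\<close>

lemma bessel_inequality:
  fixes g :: "real \<Rightarrow> complex"
  assumes [measurable]: "g \<in> borel_measurable borel"
    and g2: "integrable A (\<lambda>t. (norm (g t))\<^sup>2)"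
  shows "(\<Sum>k<N. (norm (LINT t|A. poly (P k) (- t) * g t))\<^sup>2) \<le> (LINT t|A. (norm (g t))\<^sup>2)"
proof -
  define b where "b k = (LINT t|A. poly (P k) (- t) * g t)" for k
  define S where "S t = (\<Sum>k<N. b k * poly (P k) (- t))" for t
  \<comment> \<open>The product is dominated by the sum of the two squares, by the inequality
    between arithmetic and geometric means.\<close>
  have int: "integrable A (\<lambda>t. poly (P k) (- t) * g t)" for k
  proof (rule Bochner_Integration.integrable_bound)
    show "integrable A (\<lambda>t. poly (P k) (- t) * poly (P k) (- t) + (norm (g t))\<^sup>2)"
      by (intro Bochner_Integration.integrable_add integrable_poly_mult g2)
    have "norm (of_real x * w) \<le> x * x + (norm w)\<^sup>2" for x :: real and w :: complex
    proof -
      have "2 * (\<bar>x\<bar> * norm w) \<le> x * x + (norm w)\<^sup>2"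
        using sum_squares_bound[of "\<bar>x\<bar>" "norm w"] by (simp add: power2_eq_square)
      moreover have "0 \<le> \<bar>x\<bar> * norm w"
        by simp
      ultimately show ?thesis
        unfolding norm_mult norm_of_real by linarith
    qed
    then show "AE t in A. norm (poly (P k) (- t) * g t)
        \<le> norm (poly (P k) (- t) * poly (P k) (- t) + (norm (g t))\<^sup>2)"
      by (intro AE_I2) (metis abs_ge_self order.trans real_norm_def)
  qed measurable
  have eq: "(norm (g t - S t))\<^sup>2
      = (norm (g t))\<^sup>2 - 2 * (\<Sum>k<N. Re (cnj (b k) * (poly (P k) (- t) * g t))) + (norm (S t))\<^sup>2" for t
  proof -
    have "(norm (g t - S t))\<^sup>2 = (norm (g t))\<^sup>2 - 2 * Re (cnj (S t) * g t) + (norm (S t))\<^sup>2"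
      unfolding cmod_power2 by (simp add: power2_eq_square algebra_simps)
    moreover have "Re (cnj (S t) * g t) = (\<Sum>k<N. Re (cnj (b k) * (poly (P k) (- t) * g t)))"
      unfolding S_def cnj_sum sum_distrib_right Re_sum by (simp add: mult.assoc)
    ultimately show ?thesis
      by simp
  qed
  have cross: "(LINT t|A. Re (cnj (b k) * (poly (P k) (- t) * g t))) = (norm (b k))\<^sup>2" for k
  proof -
    have "(LINT t|A. Re (cnj (b k) * (poly (P k) (- t) * g t))) = Re (cnj (b k) * b k)"
      unfolding b_def by (subst integral_Re) (simp_all only: Bochner_Integration.integrable_mult_right int
        integral_mult_right_zero)
    also have "\<dots> = (norm (b k))\<^sup>2"
      by (simp only: mult.commute[of "cnj (b k)"] complex_norm_square[symmetric] Re_complex_of_real)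
    finally show ?thesis .
  qed
  have "0 \<le> (LINT t|A. (norm (g t - S t))\<^sup>2)"
    by simp
  also have "\<dots> = (LINT t|A. (norm (g t))\<^sup>2)
      - 2 * (\<Sum>k<N. LINT t|A. Re (cnj (b k) * (poly (P k) (- t) * g t))) + (LINT t|A. (norm (S t))\<^sup>2)"
    unfolding eq
    by (simp only: Bochner_Integration.integral_add Bochner_Integration.integral_diff
        Bochner_Integration.integral_sum Bochner_Integration.integrable_sum
        Bochner_Integration.integrable_diff g2 integrable_norm_square_sum[of b N, folded S_def]
        integral_mult_right_zero Bochner_Integration.integrable_mult_right integrable_Re int)
  also have "\<dots> = (LINT t|A. (norm (g t))\<^sup>2) - (\<Sum>k<N. (norm (b k))\<^sup>2)"
    unfolding cross S_def integral_norm_square_sum by simp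
  finally show ?thesis
    by (simp add: b_def)
qed

end

section \<open>The chromatic expansion on the strip\<close>

context orthonormal_exp_measure
begin

abbreviation S :: "complex set" where
  "S \<equiv> {z. \<bar>Im z\<bar> < c}"

text \<open>The density whose transform is a partial sum of the chromatic series at
  \<open>0\<close>, so that Bessel's inequality and the derivative formulas apply to partial
  sums.\<close>

definition partial_poly :: "(nat \<Rightarrow> complex) \<Rightarrow> nat \<Rightarrow> complex poly" where
  "partial_poly d N = (\<Sum>k<N. Polynomial.smult (d k) (mirror (P k)))"

lemma poly_partial_poly: "poly (partial_poly d N) (of_real t) = (\<Sum>k<N. d k * poly (P k) (- t))"
  by (simp add: partial_poly_def poly_sum poly_mirror)

lemma fourier_partial_poly:
  assumes "z \<in> S"
  shows "fourier (partial_poly d N) z = (\<Sum>k<N. d k * diff_op (P k) (fourier 1) z)"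
  using assms by (simp add: partial_poly_def fourier_sum diff_op_fourier)

text \<open>At \<open>0\<close> the exponential kernel is \<open>1\<close>, so orthonormality picks
  out a single coefficient.\<close>

lemma diff_op_fourier_partial_poly_0:
  assumes "n < N"
  shows "diff_op (P n) (fourier (partial_poly d N)) 0 = d n"
proof -
  have "diff_op (P n) (fourier (partial_poly d N)) 0 = fourier (mirror (P n) * partial_poly d N) 0"
    using c_pos by (intro diff_op_fourier) simp
  also have "\<dots> = (LINT t|A. (\<Sum>k<N. d k * complex_of_real (poly (P n) (- t) * poly (P k) (- t))))"
    by (simp add: fourier_def poly_mirror poly_partial_poly sum_distrib_left mult_ac)
  also have "\<dots> = (\<Sum>k<N. d k * complex_of_real (LINT t|A. poly (P n) (- t) * poly (P k) (- t)))"
    by (subst Bochner_Integration.integral_sum)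
      (simp_all only: Bochner_Integration.integrable_mult_right complex_of_real_integrable_eq
        integrable_poly_mult integral_mult_right_zero integral_complex_of_real)
  also have "\<dots> = d n"
    using assms by (simp add: orthonormal if_distrib sum.delta cong: if_cong)
  finally show ?thesis .
qed

text \<open>Bessel's inequality for the kernel at \<open>z\<close>. The bound depends on neither
  \<open>z\<close> nor \<open>N\<close>, which is the source of uniformity.\<close>

lemma sum_norm_diff_op_fourier_1_le:
  assumes "z \<in> S"
  shows "(\<Sum>k<N. (norm (diff_op (P k) (fourier 1) z))\<^sup>2) \<le> (LINT t|A. exp (2 * c * \<bar>t\<bar>))"
proof -
  have le: "(norm (exp (\<i> * of_real t * z)))\<^sup>2 \<le> exp (2 * c * \<bar>t\<bar>)" for t
    using power_mono[OF norm_exp_imaginary_le[of z c t] norm_ge_zero, of 2] assms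
    by (simp add: exp_double[symmetric] mult.assoc)
  have int: "integrable A (\<lambda>t. (norm (exp (\<i> * of_real t * z)))\<^sup>2)"
    using le by (intro Bochner_Integration.integrable_bound[OF integrable_exp]) (auto simp del: norm_exp_eq_Re)
  have "diff_op (P k) (fourier 1) z = (LINT t|A. poly (P k) (- t) * exp (\<i> * of_real t * z))" for k
    using assms by (simp add: diff_op_fourier) (simp add: fourier_def poly_mirror)
  then have "(\<Sum>k<N. (norm (diff_op (P k) (fourier 1) z))\<^sup>2)
      \<le> (LINT t|A. (norm (exp (\<i> * of_real t * z)))\<^sup>2)"
    using bessel_inequality[OF _ int, of N] by simp
  also have "\<dots> \<le> (LINT t|A. exp (2 * c * \<bar>t\<bar>))"
    by (intro integral_mono int integrable_exp le)
  finally show ?thesis .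
qed

text \<open>Cauchy--Schwarz bounds each block by a tail of the summable coefficients times a
  constant uniform in \<open>z\<close>.\<close>

lemma uniformly_convergent_chromatic_series:
  assumes "summable (\<lambda>k. (norm (d k))\<^sup>2)"
  shows "uniformly_convergent_on S (\<lambda>N. fourier (partial_poly d N))"
proof (intro Cauchy_uniformly_convergent uniformly_Cauchy_onI')
  fix e :: real
  assume e: "0 < e"
  \<comment> \<open>Adding \<open>1\<close> makes \<open>B\<close> positive, so that division by it
    is safe.\<close>
  define B where "B = (LINT t|A. exp (2 * c * \<bar>t\<bar>)) + 1"
  have B: "1 \<le> B"
    by (simp add: B_def)
  then have "0 < e\<^sup>2 / B"
    using e by simp
  then obtain M where M: "\<And>m n. M \<le> m \<Longrightarrow> norm (\<Sum>k=m..<n. (norm (d k))\<^sup>2) < e\<^sup>2 / B"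
    using assms unfolding summable_Cauchy by blast
  show "\<exists>M. \<forall>z\<in>S. \<forall>m\<ge>M. \<forall>n>m. dist (fourier (partial_poly d m) z) (fourier (partial_poly d n) z) < e"
  proof (intro exI[of _ M] ballI allI impI)
    fix z and m n :: nat
    assume z: "z \<in> S" and mn: "M \<le> m" "m < n"
    let ?D = "\<lambda>k. diff_op (P k) (fourier 1) z"
    have "(\<Sum>k=m..<n. norm (d k) * norm (?D k))\<^sup>2
        \<le> (\<Sum>k=m..<n. (norm (d k))\<^sup>2) * (\<Sum>k=m..<n. (norm (?D k))\<^sup>2)"
      by (rule Cauchy_Schwarz_ineq_sum)
    also have "\<dots> \<le> (\<Sum>k=m..<n. (norm (d k))\<^sup>2) * B"
    proof (intro mult_left_mono sum_nonneg zero_le_power2)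
      have "(\<Sum>k=m..<n. (norm (?D k))\<^sup>2) \<le> (\<Sum>k<n. (norm (?D k))\<^sup>2)"
        by (intro sum_mono2) auto
      also have "\<dots> \<le> B"
        using sum_norm_diff_op_fourier_1_le[OF z, of n] by (simp add: B_def)
      finally show "(\<Sum>k=m..<n. (norm (?D k))\<^sup>2) \<le> B" .
    qed
    also have "(\<Sum>k=m..<n. (norm (d k))\<^sup>2) * B < e\<^sup>2 / B * B"
      using M[OF mn(1), of n] B by (intro mult_strict_right_mono) auto
    also have "\<dots> = e\<^sup>2"
      using B by simp
    finally have "(\<Sum>k=m..<n. norm (d k) * norm (?D k)) < e"
      using e power_less_imp_less_base less_imp_le by blast
    moreover have "fourier (partial_poly d n) z - fourier (partial_poly d m) z = (\<Sum>k=m..<n. d k * ?D k)"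
      unfolding fourier_partial_poly[OF z] using mn(2)
      by (subst sum_diff_nat_ivl[symmetric, of 0 m n]) (simp_all add: lessThan_atLeast0)
    moreover have "norm (\<Sum>k=m..<n. d k * ?D k) \<le> (\<Sum>k=m..<n. norm (d k) * norm (?D k))"
      by (intro order.trans[OF norm_sum]) (simp add: norm_mult)
    ultimately show "dist (fourier (partial_poly d m) z) (fourier (partial_poly d n) z) < e"
      by (subst dist_commute) (simp only: dist_norm)
  qed
qed

lemma chromatic_expansion_at_0:
  assumes h: "h holomorphic_on S" and sum: "summable (\<lambda>k. (norm (diff_op (P k) h 0))\<^sup>2)"
  shows "uniform_limit S (\<lambda>N. fourier (partial_poly (\<lambda>k. diff_op (P k) h 0) N)) h sequentially"
proof -
  let ?d = "\<lambda>k. diff_op (P k) h 0"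
  obtain g where g: "uniform_limit S (\<lambda>N. fourier (partial_poly ?d N)) g sequentially"
    using uniformly_convergent_chromatic_series[OF sum] unfolding uniformly_convergent_on_def by blast
  have "g holomorphic_on S"
  proof (rule holomorphic_uniform_sequence[OF open_strip_c holomorphic_fourier])
    fix x
    assume "x \<in> S"
    then obtain r where "0 < r" "cball x r \<subseteq> S"
      using open_strip_c open_contains_cball by blast
    then show "\<exists>r>0. cball x r \<subseteq> S
        \<and> uniform_limit (cball x r) (\<lambda>N. fourier (partial_poly ?d N)) g sequentially"
      using g uniform_limit_on_subset by blast
  qed
  moreover have "diff_op (P n) h 0 = diff_op (P n) g 0" for n
  proof -
    have "(\<lambda>N. diff_op (P n) (fourier (partial_poly ?d N)) 0) \<longlonglongrightarrow> diff_op (P n) g 0"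
      using c_pos by (intro tendsto_diff_op[OF g holomorphic_fourier open_strip_c]) auto
    \<comment> \<open>Once \<open>N > n\<close>, the coefficient is already the prescribed one: the
      sequence is eventually constant.\<close>
    moreover have "\<forall>\<^sub>F N in sequentially. diff_op (P n) (fourier (partial_poly ?d N)) 0 = ?d n"
      using eventually_gt_at_top[of n] by eventually_elim (rule diff_op_fourier_partial_poly_0)
    then have "(\<lambda>N. diff_op (P n) (fourier (partial_poly ?d N)) 0) \<longlonglongrightarrow> ?d n"
      by (rule tendsto_eventually)
    ultimately show ?thesis
      by (rule LIMSEQ_unique[rotated])
  qed
  then have "(deriv ^^ n) h 0 = (deriv ^^ n) g 0" for n
    by (rule higher_derivs_eq_if_diff_ops_eq[OF degree_P P_nonzero])
  moreover have "connected S"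
  proof (rule convex_connected)
    have "S = {z. Im z < c} \<inter> {z. Im z > - c}"
      by auto
    then show "convex S"
      by (simp add: convex_Int convex_halfspace_Im_lt convex_halfspace_Im_gt)
  qed
  \<comment> \<open>Identity theorem on the connected strip, from equal derivatives at
    \<open>0\<close>.\<close>
  ultimately have "h z = g z" if "z \<in> S" for z
    using that c_pos by (intro holomorphic_fun_eq_on_connected[OF h _ open_strip_c, of g 0]) auto
  then show ?thesis
    by (rule iffD2[OF uniform_limit_cong' g, OF refl])
qed

text \<open>For fixed \<open>K\<close>, the finite sum at \<open>u\<close> is the limit of the same
  sums for the partial sums of the series at \<open>0\<close>, and Bessel's inequality bounds these
  independently of \<open>K\<close> and \<open>N\<close>.\<close>

lemma summable_norm_square_diff_op:
  fixes u :: real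
  assumes h: "h holomorphic_on S" and sum: "summable (\<lambda>k. (norm (diff_op (P k) h 0))\<^sup>2)"
  shows "summable (\<lambda>k. (norm (diff_op (P k) h u))\<^sup>2)"
proof (rule summableI_nonneg_bounded)
  let ?d = "\<lambda>k. diff_op (P k) h 0"
  fix K
  have u: "\<bar>Im (of_real u)\<bar> < c"
    using c_pos by simp
  have "(\<lambda>N. \<Sum>k<K. (norm (diff_op (P k) (fourier (partial_poly ?d N)) u))\<^sup>2)
      \<longlonglongrightarrow> (\<Sum>k<K. (norm (diff_op (P k) h u))\<^sup>2)"
    using u by (intro tendsto_sum tendsto_power tendsto_norm
      tendsto_diff_op[OF chromatic_expansion_at_0[OF assms] holomorphic_fourier open_strip_c]) auto
  moreover have "(\<Sum>k<K. (norm (diff_op (P k) (fourier (partial_poly ?d N)) u))\<^sup>2) \<le> (\<Sum>k. (norm (?d k))\<^sup>2)"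
    for N
  proof -
    define q where "q t = (\<Sum>k<N. ?d k * poly (P k) (- t)) * exp (\<i> * of_real t * of_real u)" for t
    \<comment> \<open>Here \<open>u\<close> real matters: \<open>exp (\<i> * t * u)\<close> has
      modulus \<open>1\<close>.\<close>
    have q2: "(norm (q t))\<^sup>2 = (norm (\<Sum>k<N. ?d k * poly (P k) (- t)))\<^sup>2" for t
      by (simp add: q_def norm_mult)
    have [measurable]: "q \<in> borel_measurable borel"
      unfolding q_def by (intro borel_measurable_continuous_onI continuous_intros)
    have "diff_op (P k) (fourier (partial_poly ?d N)) u = (LINT t|A. poly (P k) (- t) * q t)" for k
      unfolding diff_op_fourier[OF u] fourier_def q_def by (simp add: poly_mirror poly_partial_poly mult.assoc)
    then have "(\<Sum>k<K. (norm (diff_op (P k) (fourier (partial_poly ?d N)) u))\<^sup>2) \<le> (LINT t|A. (norm (q t))\<^sup>2)"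
      using bessel_inequality[of q K] by (simp add: q2 integrable_norm_square_sum)
    also have "\<dots> = (\<Sum>k<N. (norm (?d k))\<^sup>2)"
      unfolding q2 by (rule integral_norm_square_sum)
    also have "\<dots> \<le> (\<Sum>k. (norm (?d k))\<^sup>2)"
      using sum by (intro sum_le_suminf) auto
    finally show ?thesis .
  qed
  ultimately show "(\<Sum>k<K. (norm (diff_op (P k) h u))\<^sup>2) \<le> (\<Sum>k. (norm (?d k))\<^sup>2)"
    by (intro LIMSEQ_le_const2) auto
qed simp

text \<open>Real translations preserve the strip, so the expansion at \<open>0\<close> of the
  translated function can be translated back without losing uniformity.\<close>

theorem chromatic_expansion:
  fixes u :: real
  assumes h: "h holomorphic_on S" and sum: "summable (\<lambda>k. (norm (diff_op (P k) h 0))\<^sup>2)"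
  shows "uniform_limit S
    (\<lambda>N z. \<Sum>k<N. diff_op (P k) h u * diff_op (P k) (fourier 1) (z - u)) h sequentially"
proof -
  let ?h = "\<lambda>z. h (z + complex_of_real u)"
  have "?h holomorphic_on S"
    by (rule holomorphic_on_compose_gen[OF _ h, unfolded o_def]) (auto intro!: holomorphic_intros)
  moreover have "summable (\<lambda>k. (norm (diff_op (P k) ?h 0))\<^sup>2)"
    unfolding diff_op_shift by (rule summable_norm_square_diff_op[OF assms])
  ultimately have "uniform_limit S (\<lambda>N. fourier (partial_poly (\<lambda>k. diff_op (P k) ?h 0) N)) ?h sequentially"
    by (rule chromatic_expansion_at_0)
  then have "uniform_limit S (\<lambda>N z. fourier (partial_poly (\<lambda>k. diff_op (P k) ?h 0) N) (z - u))
      (\<lambda>z. ?h (z - u)) sequentially"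
    by (rule uniform_limit_compose') auto
  then show ?thesis
    by (rule iffD2[OF uniform_limit_cong', rotated 2]) (auto simp: fourier_partial_poly diff_op_shift)
qed

end

section \<open>Exponential integrability from moment growth\<close>

text \<open>Root test: the terms are eventually below those of a geometric series. Only even indices
  are kept, to match the series of \<open>cosh\<close>.\<close>

lemma summable_exponential_moments:
  fixes \<mu> :: "nat \<Rightarrow> real"
  assumes even_nonneg: "\<And>n. even n \<Longrightarrow> 0 \<le> \<mu> n" and c: "0 < c"
    and bound: "ereal c < 1 / (2 * limsup (\<lambda>n. ereal (root n (\<mu> n / fact n))))"
  shows "summable (\<lambda>n. if even n then (2 * c) ^ n * \<mu> n / fact n else 0)"
proof -
  define L where "L = limsup (\<lambda>n. ereal (root n (\<mu> n / fact n)))"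
  \<comment> \<open>The maximum with \<open>0\<close> ensures that the \<open>r\<close> chosen below
    is positive. The value \<open>L = \<infinity>\<close> is excluded, as the bound on
    \<open>c\<close> would then be \<open>0\<close>.\<close>
  have "max L 0 < ereal (1 / (2 * c))"
  proof (cases L)
    case (real r)
    show ?thesis
    proof (cases "r \<le> 0")
      case True
      then show ?thesis
        using real c by (simp add: max_def)
    next
      case False
      then have "c < 1 / (2 * r)"
        using bound real unfolding L_def[symmetric] by (simp add: one_ereal_def)
      then show ?thesis
        using real c False by (simp add: field_simps max_def)
    qed
  qed (use bound c in \<open>auto simp: L_def[symmetric] max_def\<close>)
  then obtain r where r: "max L 0 < ereal r" "ereal r < ereal (1 / (2 * c))"
    using ereal_dense2 by blast
  then have r0: "0 < r" and small: "2 * c * r < 1"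
    using c by (simp_all add: field_simps)
  have "\<forall>\<^sub>F n in sequentially. ereal (root n (\<mu> n / fact n)) < ereal r"
    using r(1) by (intro Limsup_lessD) (simp add: L_def)
  then have "\<forall>\<^sub>F n in sequentially.
      norm (if even n then (2 * c) ^ n * \<mu> n / fact n else 0) \<le> (2 * c * r) ^ n"
    \<comment> \<open>\<open>root 0\<close> is \<open>0\<close> by default, so
      \<open>x = root n x ^ n\<close> is used for positive \<open>n\<close> only.\<close>
    using eventually_gt_at_top[of 0]
  proof eventually_elim
    case (elim n)
    show ?case
    proof (cases "even n")
      case True
      then have nonneg: "0 \<le> \<mu> n / fact n"
        using even_nonneg by simp
      then have "\<mu> n / fact n = root n (\<mu> n / fact n) ^ n"
        using elim(2) by simp
      also have "\<dots> \<le> r ^ n"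
        using elim nonneg by (intro power_mono) auto
      finally have "(2 * c) ^ n * (\<mu> n / fact n) \<le> (2 * c) ^ n * r ^ n"
        using c by (intro mult_left_mono) auto
      then show ?thesis
        using True c even_nonneg by (simp add: power_mult_distrib)
    qed (use c r0 in simp)
  qed
  moreover have "summable (\<lambda>n. (2 * c * r) ^ n)"
    using small c r0 by (intro summable_geometric) simp
  ultimately show ?thesis
    by (rule summable_comparison_test_ev)
qed

text \<open>\<open>exp \<bar>x\<bar> \<le> 2 * cosh x\<close>, and the series of \<open>cosh\<close>
  has only even powers. Its terms are nonnegative, so their integrals are given by moments directly
  and termwise integration applies.\<close>

lemma integrable_exp_if_moments:
  fixes A :: "real measure" and \<mu> :: "nat \<Rightarrow> real"
  assumes sets_A [measurable_cong]: "sets A = sets borel"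
    and moments: "\<And>n. has_bochner_integral A (\<lambda>t. t ^ n) (\<mu> n)"
    and c: "0 < c"
    and bound: "ereal c < 1 / (2 * limsup (\<lambda>n. ereal (root n (\<mu> n / fact n))))"
  shows "integrable A (\<lambda>t. exp (2 * c * \<bar>t\<bar>))"
proof -
  have int: "integrable A (\<lambda>t. t ^ n)" and moment: "(LINT t|A. t ^ n) = \<mu> n" for n
    using moments by (auto simp: has_bochner_integral_iff)
  define f where "f n t = (if even n then (2 * c * t) ^ n /\<^sub>R fact n else 0)" for n and t :: real
  have f_sums: "(\<lambda>n. f n t) sums cosh (2 * c * t)" for t
    unfolding f_def by (rule cosh_converges)
  have f_nonneg: "0 \<le> f n t" for n t
    by (simp add: f_def zero_le_even_power)
  have f_eq: "f n t = (if even n then (2 * c) ^ n / fact n else 0) * t ^ n" for n t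
    by (simp add: f_def power_mult_distrib divide_inverse)
  have f_int: "integrable A (f n)" for n
    unfolding f_eq by (intro Bochner_Integration.integrable_mult_right int)
  have "0 \<le> \<mu> n" if "even n" for n
    unfolding moment[symmetric] using that by (intro Bochner_Integration.integral_nonneg) (simp add: zero_le_even_power)
  then have "summable (\<lambda>n. if even n then (2 * c) ^ n * \<mu> n / fact n else 0)"
    using c bound by (rule summable_exponential_moments)
  also have "(\<lambda>n. if even n then (2 * c) ^ n * \<mu> n / fact n else 0) = (\<lambda>n. LINT t|A. norm (f n t))"
    using f_nonneg by (simp add: f_eq fun_eq_iff moment)
  finally have "integrable A (\<lambda>t. \<Sum>n. f n t)"
    using f_int f_sums f_nonneg by (intro integrable_suminf) (auto simp: sums_iff)
  then have "integrable A (\<lambda>t. 2 * cosh (2 * c * t))"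
    using f_sums by (simp add: sums_iff)
  then show ?thesis
  proof (rule Bochner_Integration.integrable_bound)
    have "exp \<bar>x\<bar> \<le> 2 * cosh x" for x :: real
      by (cases "0 \<le> x") (simp_all add: cosh_def)
    from this[of "2 * c * _"] show "AE t in A. norm (exp (2 * c * \<bar>t\<bar>)) \<le> norm (2 * cosh (2 * c * t))"
      using c by (intro AE_I2) (simp add: abs_mult)
  qed measurable
qed

section \<open>From the functional and chromatic derivatives to the measure\<close>

text \<open>Reflection only changes the signs of odd powers, and the odd moments vanish.\<close>

lemma moment_functional_eq_integral:
  assumes "moment_functional \<M>" "\<And>n. has_bochner_integral A (\<lambda>t. t ^ n) (moment \<M> n)"
  shows "(LINT t|A. poly p (- t)) = \<M> p"
proof -
  interpret Vector_Spaces.linear Polynomial.smult "(*)" \<M>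
    using assms(1) by (simp add: moment_functional_def)
  have int: "integrable A (\<lambda>t. t ^ n)" and moment: "(LINT t|A. t ^ n) = moment \<M> n" for n
    using assms(2) by (auto simp: has_bochner_integral_iff)
  have odd: "moment \<M> n = 0" if "odd n" for n
    using assms(1) that by (auto simp: moment_functional_def elim!: oddE)
  have "poly p (- t) = (\<Sum>k\<le>degree p. coeff p k * (- 1) ^ k * t ^ k)" for t
    unfolding poly_altdef by (intro sum.cong refl) (metis mult.assoc mult_minus1 power_mult_distrib)
  then have "(LINT t|A. poly p (- t)) = (\<Sum>k\<le>degree p. coeff p k * (- 1) ^ k * moment \<M> k)"
    by (simp only: Bochner_Integration.integral_sum Bochner_Integration.integrable_mult_right int
        integral_mult_right_zero moment)
  also have "\<dots> = (\<Sum>k\<le>degree p. coeff p k * moment \<M> k)"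
  proof (intro sum.cong refl)
    show "coeff p k * (- 1) ^ k * moment \<M> k = coeff p k * moment \<M> k" for k
      using odd[of k] by (cases "even k") auto
  qed
  also have "\<dots> = (\<Sum>k\<le>degree p. \<M> (Polynomial.smult (coeff p k) (monom 1 k)))"
    by (simp only: scale moment_def)
  also have "\<dots> = \<M> (\<Sum>k\<le>degree p. monom (coeff p k) k)"
    by (simp add: sum[symmetric] smult_monom)
  finally show ?thesis
    by (simp add: poly_as_sum_of_monoms)
qed

lemma chromatic_deriv_eq_diff_op: "chromatic_deriv P n h z = \<i> powi (- int n) * diff_op (P n) h z"
  by (simp add: chromatic_deriv_def diff_op_def)

lemma norm_chromatic_deriv: "norm (chromatic_deriv P n h z) = norm (diff_op (P n) h z)"
  by (simp add: chromatic_deriv_eq_diff_op norm_mult norm_power_int)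

text \<open>The two factors \<open>\<i> powi (- int k)\<close> multiply to \<open>(-1) ^ k\<close>,
  which cancels the sign in the chromatic series.\<close>

lemma chromatic_deriv_mult:
  "(-1) ^ k * chromatic_deriv P k g z * chromatic_deriv P k h w = diff_op (P k) g z * diff_op (P k) h w"
proof -
  have "\<i> powi (- int k) * \<i> powi (- int k) = (-1) ^ k"
    by (simp add: power_int_minus flip: power_inverse power_mult_distrib)
  then have "(-1) ^ k * (\<i> powi (- int k) * \<i> powi (- int k)) = 1"
    by (simp flip: power_mult_distrib)
  then show ?thesis
    unfolding chromatic_deriv_eq_diff_op by (simp add: algebra_simps)
qed

theorem proposition4p16:
  fixes \<M> :: "real poly \<Rightarrow> real"
    and P :: "nat \<Rightarrow> real poly"
    and a :: "real \<Rightarrow> real"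
    and f :: "complex \<Rightarrow> complex"
    and u c :: real
  assumes "chromatic \<M>"
    and "orthonormal_polys \<M> P"
    and "moment_distribution \<M> a"
    and "f \<in> L2_space \<M> P"
    and "0 < c"
    and "ereal c < 1 / (2 * rho \<M>)"
  shows "uniform_limit (strip (ereal c))
           (\<lambda>N z. \<Sum>k<N. (-1) ^ k * chromatic_deriv P k f (of_real u)
                              * chromatic_deriv P k (fourier_stieltjes a) (z - of_real u))
           f sequentially"
proof -
  have sets: "sets (stieltjes_measure a) = sets borel"
    by (simp add: stieltjes_measure_def)
  have moments: "has_bochner_integral (stieltjes_measure a) (\<lambda>t. t ^ n) (moment \<M> n)" for n
    using assms(3) by (simp add: moment_distribution_def)
  interpret orthonormal_exp_measure "stieltjes_measure a" c P
  proof
    show "integrable (stieltjes_measure a) (\<lambda>t. exp (2 * c * \<bar>t\<bar>))"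
      using sets moments assms(5,6) unfolding rho_def by (rule integrable_exp_if_moments)
    show "degree (P n) = n" for n
      using assms(2) by (simp add: orthonormal_polys_def)
    have "\<M> (P m * P n) = (if m = n then 1 else 0)" for m n
      using assms(2) by (auto simp: orthonormal_polys_def)
    then show "(LINT t|stieltjes_measure a. poly (P m) (- t) * poly (P n) (- t)) = (if m = n then 1 else 0)" for m n
      using moment_functional_eq_integral[OF _ moments, of "P m * P n"] assms(1) by (simp add: chromatic_def)
  qed (use sets assms(5) in auto)
  have strip: "strip (ereal c) = S"
    by (simp add: strip_def)
  have "S \<subseteq> strip (1 / (2 * rho \<M>))"
    using assms(6) by (auto simp: strip_def intro: less_trans[of _ "ereal c"])
  then have "f holomorphic_on S"
    using assms(4) analytic_on_subset analytic_imp_holomorphic unfolding L2_space_def by blast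
  moreover have "summable (\<lambda>n. (norm (diff_op (P n) f 0))\<^sup>2)"
    using assms(4) by (simp add: L2_space_def norm_chromatic_deriv)
  moreover have "fourier_stieltjes a = fourier 1"
    by (simp add: fun_eq_iff fourier_stieltjes_def fourier_def)
  ultimately show ?thesis
    unfolding strip chromatic_deriv_mult by (simp only: chromatic_expansion)
qed

end
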